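(* Let $\mathcal{M}=(K_{i(e)},w_e,p_e)_{e\in E}$ be a countable Markov system on a complete metric space $(K,d)$, and suppose $\mathcal{M}$ is uniformly continuous. Then $\mathcal{M}$ is non-degenerate if $F^{-1}(\Omega)$ is empty.
   Context: Setting. $(K,d)$ is a complete metric space. A countable Markov system $\mathcal{M}=(K_{i(e)},w_e,p_e)_{e\in E}$ on $K$ consists of: a set $N\subset\mathbb{N}$ with $1\in N$; a partition $(K_j)_{j\in N}$ of $K$ into non-empty Borel sets; an at most countable set $E$; a surjective map $i:E\to N$ and a map $t:E\to N$; for each $e\in E$, Borel measurable $w_e:K_{i(e)}\to K_{t(e)}$ and $p_e:K_{i(e)}\to[0,1]$ with $p_e\not\equiv 0$, such that $\sum_{e\in E,\,i(e)=j}p_e(x)=1$ for all $x\in K_j$, $j\in N$. Each $p_e$ is extended to $K$ by zero and each $w_e$ is extended to a Borel map $K\to K$ arbitrarily. $\mathcal{M}$ is uniformly continuous iff $w_e|_{K_{i(e)}}$ and $p_e|_{K_{i(e)}}$ are uniformly continuous for each $e\in E$. In that case $\bar w_e$ is the continuous extension of $w_e|_{K_{i(e)}}$ to $\bar K_{i(e)}$ (extended arbitrarily to a Borel map on $K$), $\bar p_e$ is the continuous extension of $p_e|_{K_{i(e)}}$ to $\bar K_{i(e)}$, extended by zero to $K$, and $\partial p_e:=\bar p_e1_{\bar K_{i(e)}\setminus K_{i(e)}}$. $Rf:=\sum_{e\in E}\partial p_e\,f\circ\bar w_e$ for Borel $f:K\to[0,+\infty]$, and $\Omega:=\bigcap_{n\in\mathbb{N}}\{x\in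 K:(R^n1)(x)\ge1\}$. Code space. $\bar E:=E\cup\{\infty\}$ is the one-point compactification of discrete $E$; $w_\infty:=\mathrm{id}$, $p_\infty:=0$, $i(\infty)=t(\infty):=1$. $\bar\Sigma:=\bar E^{\mathbb{Z}}$ with the product topology; $(S\sigma)_{i-1}=\sigma_i$; $P_S(\bar\Sigma)$ is the set of $S$-invariant Borel probability measures. ${}_m[e_m,\dots,e_n]:=\{\sigma\in\bar\Sigma:\sigma_i=e_i,\ m\le i\le n\}$. $\mathcal{F}$ is the $\sigma$-algebra generated by all cylinders ${}_m[e_m,\dots,e_0]$, $m\le 0$. $\Sigma_G:=\{\sigma\in\bar\Sigma: \sigma_n\in E,\ i(\sigma_{n+1})=t(\sigma_n)\ \forall n\in\mathbb{Z}\}$. Fix $x_i\in K_i$ for each $i\in N$. $D:=\{\sigma\in\Sigma_G:\lim_{m\to-\infty}w_{\sigma_0}\circ\dots\circ w_{\sigma_m}(x_{i(\sigma_m)})\text{ exists}\}$; $F:\bar\Sigma\to K$ is this limit on $D$, and $F(\sigma):=x_{t(\sigma_0)}$ for $\sigma\notin D$. $T_j:=\{\sigma\in\Sigma_G:t(\sigma_0)=j\}$. $\tilde E(\mathcal{M})$ is the set of $\Lambda\in P_S(\bar\Sigma)$ with $\Lambda(D)=1$ and $E_\Lambda(1_{{}_1[e]}|\mathcal{F})=(\bar p_e\circ F)\,1_{T_{i(e)}}$ $\Lambda$-a.e. for all $e\in E$. $\mathcal{M}$ is non-degenerate iff for every $\Lambda\in\tilde E(\mathcal{M})$ there exists $i\in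 N$ with $\Lambda(T_i\cap F^{-1}(K_i))>0$. *)

theory Defs
  imports "HOL-Probability.Probability"
begin

text \<open>
  The complete metric space is the type \<open>'a\<close>; the alphabet \<open>E\<close> is a subset of the type \<open>'e\<close>.
  The maps \<open>w\<^sub>e\<close> and \<open>p\<^sub>e\<close> are carried already extended to the whole space.
\<close>

record ('a, 'e) cms =
  verts :: "nat set"
  piece :: "nat \<Rightarrow> 'a set"
  edges :: "'e set"
  ini :: "'e \<Rightarrow> nat"
  ter :: "'e \<Rightarrow> nat"
  wmap :: "'e \<Rightarrow> 'a \<Rightarrow> 'a"
  pfun :: "'e \<Rightarrow> 'a \<Rightarrow> real"

abbreviation ipiece :: "('a, 'e) cms \<Rightarrow> 'e \<Rightarrow> 'a set" where
  "ipiece M e \<equiv> piece M (ini M e)"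

definition markov_system :: "('a::complete_space, 'e) cms \<Rightarrow> bool" where
  "markov_system M \<longleftrightarrow>
     1 \<in> verts M \<and>
     (\<forall>j\<in>verts M. piece M j \<noteq> {} \<and> piece M j \<in> sets borel) \<and>
     disjoint_family_on (piece M) (verts M) \<and>
     (\<Union>j\<in>verts M. piece M j) = UNIV \<and>
     countable (edges M) \<and>
     ini M ` edges M = verts M \<and>
     ter M ` edges M \<subseteq> verts M \<and>
     (\<forall>e\<in>edges M.
        wmap M e \<in> borel_measurable borel \<and>
        wmap M e ` ipiece M e \<subseteq> piece M (ter M e) \<and>
        pfun M e \<in> borel_measurable borel \<and>
        (\<forall>x. pfun M e x \<in> {0..1}) \<and>
        (\<forall>x. x \<notin> ipiece M e \<longrightarrow> pfun M e x = 0) \<and>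
        (\<exists>x\<in>ipiece M e. pfun M e x \<noteq> 0)) \<and>
     (\<forall>j\<in>verts M. \<forall>x\<in>piece M j.
        ((\<lambda>e. pfun M e x) has_sum 1) {e \<in> edges M. ini M e = j})"

definition uniformly_continuous_system :: "('a::complete_space, 'e) cms \<Rightarrow> bool" where
  "uniformly_continuous_system M \<longleftrightarrow>
     (\<forall>e\<in>edges M. uniformly_continuous_on (ipiece M e) (wmap M e) \<and>
                   uniformly_continuous_on (ipiece M e) (pfun M e))"

definition continuous_extension ::
    "'a::metric_space set \<Rightarrow> ('a \<Rightarrow> 'b::metric_space) \<Rightarrow> ('a \<Rightarrow> 'b) \<Rightarrow> bool" where
  "continuous_extension A f g \<longleftrightarrow>
     continuous_on (closure A) g \<and> (\<forall>x\<in>A. g x = f x)"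

lemma continuous_extension_exists:
  fixes f :: "'a::metric_space \<Rightarrow> 'b::complete_space"
  assumes "uniformly_continuous_on A f"
  shows "\<exists>g. continuous_extension A f g"
proof -
  obtain g where g: "uniformly_continuous_on (closure A) g" "\<And>x. x \<in> A \<Longrightarrow> f x = g x"
    by (rule uniformly_continuous_on_extension_on_closure[OF assms]) (rule that)
  have "continuous_extension A f g"
    unfolding continuous_extension_def
    using uniformly_continuous_imp_continuous[OF g(1)] g(2) by simp
  then show ?thesis by blast
qed

lemma continuous_extension_unique:
  fixes f :: "'a::metric_space \<Rightarrow> 'b::metric_space"
  assumes "continuous_extension A f g" "continuous_extension A f h" "x \<in> closure A"
  shows "g x = h x"
proof -
  obtain s where s: "\<And>n. s n \<in> A" "s \<longlonglongrightarrow> x"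
    using assms(3) by (auto simp: closure_sequential)
  have "s n \<in> closure A" for n
    using s(1) closure_subset by blast
  then have lim: "(\<lambda>n. k (s n)) \<longlonglongrightarrow> k x" if "continuous_extension A f k" for k
    using that continuous_on_tendsto_compose[OF _ s(2) assms(3), of k]
    unfolding continuous_extension_def by simp
  have "g (s n) = h (s n)" for n
    using assms(1,2) s(1) unfolding continuous_extension_def by simp
  then have "(\<lambda>n. h (s n)) \<longlonglongrightarrow> g x"
    using lim[OF assms(1)] by simp
  then show ?thesis
    using lim[OF assms(2)] by (rule LIMSEQ_unique)
qed

text \<open>
  Off the closure of the initial piece, \<open>\<bar>w\<^sub>e\<close> is an arbitrary Borel extension, so the family
  is a parameter \<open>v\<close> subject to the following condition.
\<close>

definition closure_maps :: "('a::complete_space, 'e) cms \<Rightarrow> ('e \<Rightarrow> 'a \<Rightarrow> 'a) \<Rightarrow> bool" where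
  "closure_maps M v \<longleftrightarrow>
     (\<forall>e\<in>edges M. continuous_extension (ipiece M e) (wmap M e) (v e) \<and>
                   v e \<in> borel_measurable borel)"

text \<open>
  A continuous extension is determined on the closure, so the choice below is immaterial.
  It exists when the system is uniformly continuous.
\<close>

definition pbar :: "('a::complete_space, 'e) cms \<Rightarrow> 'e \<Rightarrow> 'a \<Rightarrow> real" where
  "pbar M e x =
     (if x \<in> closure (ipiece M e)
      then (SOME g. continuous_extension (ipiece M e) (pfun M e) g) x else 0)"

definition boundary_p :: "('a::complete_space, 'e) cms \<Rightarrow> 'e \<Rightarrow> 'a \<Rightarrow> real" where
  "boundary_p M e x = pbar M e x * indicator (closure (ipiece M e) - ipiece M e) x"

definition boundary_op ::
    "('a::complete_space, 'e) cms \<Rightarrow> ('e \<Rightarrow> 'a \<Rightarrow> 'a) \<Rightarrow> ('a \<Rightarrow> ennreal) \<Rightarrow> 'a \<Rightarrow> ennreal" where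
  "boundary_op M v f x = (\<Sum>\<^sub>\<infinity>e\<in>edges M. ennreal (boundary_p M e x) * f (v e x))"

definition Omega_set :: "('a::complete_space, 'e) cms \<Rightarrow> ('e \<Rightarrow> 'a \<Rightarrow> 'a) \<Rightarrow> 'a set" where
  "Omega_set M v = (\<Inter>n. {x. (boundary_op M v ^^ n) (\<lambda>_. 1) x \<ge> 1})"

text \<open>In the code space the point \<open>\<infinity>\<close> is \<^term>\<open>None\<close>.\<close>

definition code_topology :: "'e set \<Rightarrow> (int \<Rightarrow> 'e option) topology" where
  "code_topology E =
     product_topology (\<lambda>_. Alexandroff_compactification (discrete_topology E)) UNIV"

abbreviation code_space :: "'e set \<Rightarrow> (int \<Rightarrow> 'e option) set" where
  "code_space E \<equiv> topspace (code_topology E)"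

definition code_borel :: "'e set \<Rightarrow> (int \<Rightarrow> 'e option) measure" where
  "code_borel E = sigma (code_space E) {U. openin (code_topology E) U}"

definition shift :: "(int \<Rightarrow> 'e option) \<Rightarrow> int \<Rightarrow> 'e option" where
  "shift \<sigma> = (\<lambda>k. \<sigma> (k + 1))"

definition invariant_probs :: "'e set \<Rightarrow> (int \<Rightarrow> 'e option) measure set" where
  "invariant_probs E =
     {\<Lambda>. prob_space \<Lambda> \<and> sets \<Lambda> = sets (code_borel E) \<and> distr \<Lambda> \<Lambda> shift = \<Lambda>}"

text \<open>Only the values of \<open>c\<close> on \<open>{m..n}\<close> matter.\<close>

definition cylinder ::
    "'e set \<Rightarrow> int \<Rightarrow> int \<Rightarrow> (int \<Rightarrow> 'e option) \<Rightarrow> (int \<Rightarrow> 'e option) set" where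
  "cylinder E m n c = {\<sigma> \<in> code_space E. \<forall>k\<in>{m..n}. \<sigma> k = c k}"

definition past_algebra :: "'e set \<Rightarrow> (int \<Rightarrow> 'e option) measure" where
  "past_algebra E =
     sigma (code_space E) {cylinder E m 0 c | m c. m \<le> 0 \<and> c \<in> code_space E}"

definition ini_ext :: "('a, 'e) cms \<Rightarrow> 'e option \<Rightarrow> nat" where
  "ini_ext M = case_option 1 (ini M)"

definition ter_ext :: "('a, 'e) cms \<Rightarrow> 'e option \<Rightarrow> nat" where
  "ter_ext M = case_option 1 (ter M)"

definition wmap_ext :: "('a, 'e) cms \<Rightarrow> 'e option \<Rightarrow> 'a \<Rightarrow> 'a" where
  "wmap_ext M = case_option id (wmap M)"

definition Sigma_G :: "('a, 'e) cms \<Rightarrow> (int \<Rightarrow> 'e option) set" where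
  "Sigma_G M = {\<sigma> \<in> code_space (edges M).
     \<forall>n. \<sigma> n \<in> Some ` edges M \<and> ini_ext M (\<sigma> (n + 1)) = ter_ext M (\<sigma> n)}"

text \<open>\<^term>\<open>past_map M \<sigma> n\<close> is \<open>w\<^bsub>\<sigma> 0\<^esub> \<circ> \<dots> \<circ> w\<^bsub>\<sigma> (-n)\<^esub>\<close>.\<close>

primrec past_map :: "('a, 'e) cms \<Rightarrow> (int \<Rightarrow> 'e option) \<Rightarrow> nat \<Rightarrow> 'a \<Rightarrow> 'a" where
  "past_map M \<sigma> 0 = wmap_ext M (\<sigma> 0)"
| "past_map M \<sigma> (Suc n) = past_map M \<sigma> n \<circ> wmap_ext M (\<sigma> (- int (Suc n)))"

definition coding_seq ::
    "('a, 'e) cms \<Rightarrow> (nat \<Rightarrow> 'a) \<Rightarrow> (int \<Rightarrow> 'e option) \<Rightarrow> nat \<Rightarrow> 'a" where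
  "coding_seq M x \<sigma> n = past_map M \<sigma> n (x (ini_ext M (\<sigma> (- int n))))"

definition coding_dom ::
    "('a::complete_space, 'e) cms \<Rightarrow> (nat \<Rightarrow> 'a) \<Rightarrow> (int \<Rightarrow> 'e option) set" where
  "coding_dom M x = {\<sigma> \<in> Sigma_G M. convergent (coding_seq M x \<sigma>)}"

definition coding_map ::
    "('a::complete_space, 'e) cms \<Rightarrow> (nat \<Rightarrow> 'a) \<Rightarrow> (int \<Rightarrow> 'e option) \<Rightarrow> 'a" where
  "coding_map M x \<sigma> =
     (if \<sigma> \<in> coding_dom M x then lim (coding_seq M x \<sigma>) else x (ter_ext M (\<sigma> 0)))"

definition T_set :: "('a, 'e) cms \<Rightarrow> nat \<Rightarrow> (int \<Rightarrow> 'e option) set" where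
  "T_set M j = {\<sigma> \<in> Sigma_G M. ter_ext M (\<sigma> 0) = j}"

definition E_tilde ::
    "('a::complete_space, 'e) cms \<Rightarrow> (nat \<Rightarrow> 'a) \<Rightarrow> (int \<Rightarrow> 'e option) measure set" where
  "E_tilde M x =
     {\<Lambda> \<in> invariant_probs (edges M).
        measure \<Lambda> (coding_dom M x) = 1 \<and>
        (\<forall>e\<in>edges M. AE \<sigma> in \<Lambda>.
           real_cond_exp \<Lambda> (past_algebra (edges M))
             (indicator (cylinder (edges M) 1 1 (\<lambda>_. Some e))) \<sigma>
           = pbar M e (coding_map M x \<sigma>) * indicator (T_set M (ini M e)) \<sigma>)}"

definition non_degenerate :: "('a::complete_space, 'e) cms \<Rightarrow> (nat \<Rightarrow> 'a) \<Rightarrow> bool" where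
  "non_degenerate M x \<longleftrightarrow>
     (\<forall>\<Lambda>\<in>E_tilde M x. \<exists>j\<in>verts M.
        measure \<Lambda> (T_set M j \<inter> coding_map M x -` piece M j) > 0)"

end

theory Submission
  imports Defs
begin

text \<open>
  A measure \<open>\<Lambda> \<in> E_tilde M x\<close> that violates non-degeneracy lives on codes whose image lies in the boundary
  of the piece where it should be: the coding map \<open>F\<close> has values in the closure of \<open>K\<^bsub>t(\<sigma>\<^sub>0)\<^esub>\<close>, and by
  assumption almost never in \<open>K\<^bsub>t(\<sigma>\<^sub>0)\<^esub>\<close> itself. At such codes the conditional probability of the next
  letter \<open>e\<close> given the past is bounded by the boundary part \<open>\<partial>p\<^sub>e \<circ> F\<close>. If the next letter is \<open>e\<close>, then
  \<open>F \<circ> S = \<bar>w\<^sub>e \<circ> F\<close>. Summing over \<open>e\<close> gives \<open>E(g \<circ> F \<circ> S | past) \<le> (R g) \<circ> F\<close> for all Borel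
  \<open>g \<ge> 0\<close> (\<open>boundary_op_dominates_shift\<close>).

  For \<open>g = R\<^sup>n 1\<close> this is an induction step. If \<open>(R\<^sup>n 1) \<circ> F \<ge> 1\<close> almost surely, then by shift invariance
  also \<open>(R\<^sup>n 1) \<circ> F \<circ> S \<ge> 1\<close> almost surely, and conditioning yields \<open>(R\<^bsup>n+1\<^esup> 1) \<circ> F \<ge> 1\<close>
  (\<open>one_le_boundary_op\<close>). Hence \<open>F\<close> lies in \<open>\<Omega>\<close> almost surely, and \<open>F\<^sup>-\<^sup>1(\<Omega>)\<close> cannot be empty.

  Two measurability questions need care. The space \<open>K\<close> is not assumed separable, so limits and
  distances are handled through events that depend on finitely many letters
  (\<open>window_determined_in_sets\<close>). And \<open>F\<close> is measurable with respect to the past only up to a null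
  set; it is replaced by the limit \<open>past_limit\<close>, which is defined from the past alone.
\<close>

section \<open>Borel sets and the past in the code space\<close>

lemma code_space_iff: "\<sigma> \<in> code_space E \<longleftrightarrow> (\<forall>k. \<sigma> k \<in> insert None (Some ` E))"
  by (auto simp: code_topology_def topspace_product_topology PiE_def Pi_def)

lemma space_code_borel [simp]: "space (code_borel E) = code_space E"
  unfolding code_borel_def by (intro space_measure_of) (auto dest: openin_subset)

lemma sets_code_borel: "sets (code_borel E) = sigma_sets (code_space E) {U. openin (code_topology E) U}"
  unfolding code_borel_def by (intro sets_measure_of) (auto dest: openin_subset)

lemma space_past_algebra [simp]: "space (past_algebra E) = code_space E"
  unfolding past_algebra_def by (intro space_measure_of) (auto simp: cylinder_def)

lemma sets_past_algebra:
  "sets (past_algebra E) =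
     sigma_sets (code_space E) {cylinder E m 0 c | m c. m \<le> 0 \<and> c \<in> code_space E}"
  unfolding past_algebra_def by (intro sets_measure_of) (auto simp: cylinder_def)

lemma open_in_code_borel: "openin (code_topology E) U \<Longrightarrow> U \<in> sets (code_borel E)"
  by (auto simp: sets_code_borel)

lemma coordinate_in_code_borel: "{\<sigma> \<in> code_space E. \<sigma> k = a} \<in> sets (code_borel E)"
proof -
  have cont: "continuous_map (code_topology E)
      (Alexandroff_compactification (discrete_topology E)) (\<lambda>\<sigma>. \<sigma> k)"
    unfolding code_topology_def by (rule continuous_map_product_projection) simp
  have opn: "{\<sigma> \<in> code_space E. \<sigma> k \<in> Some ` U} \<in> sets (code_borel E)" if "U \<subseteq> E" for U
    using that by (intro open_in_code_borel openin_continuous_map_preimage[OF cont]) simp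
  have coord: "\<sigma> k = None \<or> \<sigma> k \<in> Some ` E" if "\<sigma> \<in> code_space E" for \<sigma>
    using that unfolding code_space_iff by blast
  show ?thesis
  proof (cases a)
    case None
    have "{\<sigma> \<in> code_space E. \<sigma> k = a} =
        space (code_borel E) - {\<sigma> \<in> code_space E. \<sigma> k \<in> Some ` E}"
      unfolding None using coord by fastforce
    then show ?thesis using sets.compl_sets[OF opn[OF order_refl]] by (simp only:)
  next
    case (Some e)
    show ?thesis
    proof (cases "e \<in> E")
      case True
      then show ?thesis using opn[of "{e}"] Some by simp
    next
      case False
      then have "{\<sigma> \<in> code_space E. \<sigma> k = a} = {}"
        using Some by (auto simp: code_space_iff)
      then show ?thesis by (simp only: sets.empty_sets)
    qed
  qed
qed

lemma cylinder_in_code_borel: "cylinder E m n c \<in> sets (code_borel E)"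
proof -
  have "{\<sigma> \<in> space (code_borel E). \<forall>k\<in>{m..n}. \<sigma> k = c k} \<in> sets (code_borel E)"
    by (intro sets.sets_Collect_finite_All) (use coordinate_in_code_borel in auto)
  then show ?thesis by (simp add: cylinder_def)
qed

lemma cylinder_in_past_algebra:
  "m \<le> 0 \<Longrightarrow> c \<in> code_space E \<Longrightarrow> cylinder E m 0 c \<in> sets (past_algebra E)"
  unfolding sets_past_algebra by (intro sigma_sets.Basic) blast

lemma past_algebra_le_code_borel: "sets (past_algebra E) \<subseteq> sets (code_borel E)"
  unfolding sets_past_algebra
  by (intro sets.sigma_sets_subset[of _ "code_borel E", simplified])
     (use cylinder_in_code_borel in auto)

lemma shift_code_space: "shift \<sigma> \<in> code_space E \<longleftrightarrow> \<sigma> \<in> code_space E"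
  unfolding code_space_iff shift_def by (metis diff_add_cancel)

lemma shift_measurable: "shift \<in> measurable (code_borel E) (code_borel E)"
proof (rule measurable_sigma_sets[OF sets_code_borel])
  have "continuous_map (code_topology E) (code_topology E) shift"
    unfolding code_topology_def continuous_map_componentwise_UNIV shift_def
    by (intro allI continuous_map_product_projection) simp
  then show "shift -` U \<inter> space (code_borel E) \<in> sets (code_borel E)"
    if "U \<in> {U. openin (code_topology E) U}" for U
    using that openin_continuous_map_preimage[of "code_topology E" "code_topology E" shift U]
    by (intro open_in_code_borel) (simp add: Int_def vimage_def conj_commute)
qed (auto simp: shift_code_space dest: openin_subset)

text \<open>
  As \<open>E\<close> is countable, a finite window carries only countably many words, so an event that depends on
  such a window is a countable union of cylinders. Arbitrary functions of finitely many letters are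
  therefore measurable, with no condition on their values; this is what makes the approximants of the
  coding map measurable although \<open>K\<close> need not be separable.
\<close>

lemma window_determined_in_sets:
  assumes "countable E" and space: "space N = code_space E"
    and cyl: "\<And>c. c \<in> code_space E \<Longrightarrow> cylinder E m n c \<in> sets N"
    and det: "\<And>\<sigma> \<tau>. \<sigma> \<in> code_space E \<Longrightarrow> \<tau> \<in> code_space E \<Longrightarrow> (\<And>k. k \<in> {m..n} \<Longrightarrow> \<sigma> k = \<tau> k) \<Longrightarrow>
      P \<sigma> \<Longrightarrow> P \<tau>"
  shows "{\<sigma> \<in> code_space E. P \<sigma>} \<in> sets N"
proof -
  let ?A = "{\<sigma> \<in> code_space E. P \<sigma>}"
  define words where "words = PiE {m..n} (\<lambda>_. insert None (Some ` E))"
  have "countable words"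
    unfolding words_def using assms(1) by (intro countable_PiE) auto
  moreover have "cylinder E m n ` ?A \<subseteq> cylinder E m n ` words"
  proof (rule image_subsetI)
    fix \<sigma> assume "\<sigma> \<in> ?A"
    then have "restrict \<sigma> {m..n} \<in> words"
      by (simp add: words_def code_space_iff restrict_def PiE_def extensional_def Pi_def)
    moreover have "cylinder E m n \<sigma> = cylinder E m n (restrict \<sigma> {m..n})"
      by (simp add: cylinder_def)
    ultimately show "cylinder E m n \<sigma> \<in> cylinder E m n ` words"
      by (metis imageI)
  qed
  ultimately have "countable (cylinder E m n ` ?A)"
    by (meson countable_image countable_subset)
  then have "\<Union> (cylinder E m n ` ?A) \<in> sets N"
    using cyl by (intro sets.countable_Union) auto
  moreover have "\<tau> \<in> ?A" if "\<sigma> \<in> ?A" "\<tau> \<in> cylinder E m n \<sigma>" for \<sigma> \<tau>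
    using that det[of \<sigma> \<tau>] by (simp add: cylinder_def)
  then have "?A = \<Union> (cylinder E m n ` ?A)"
    by (auto simp: cylinder_def)
  ultimately show ?thesis by simp
qed

section \<open>Countable sums and conditional probabilities\<close>

lemma infsum_eq_nn_integral_count_space:
  fixes f :: "'b \<Rightarrow> ennreal"
  assumes "countable A"
  shows "(\<Sum>\<^sub>\<infinity>a\<in>A. f a) = (\<integral>\<^sup>+a. f a \<partial>count_space A)"
proof (cases "finite A")
  case True
  then show ?thesis by (simp add: nn_integral_count_space_finite)
next
  case False
  note bij = bij_betw_from_nat_into[OF assms False]
  have sums: "(\<lambda>n. f (from_nat_into A n)) sums (\<Sum>\<^sub>\<infinity>n. f (from_nat_into A n))"
    by (intro has_sum_imp_sums has_sum_infsum nonneg_summable_on_complete) simp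
  have "(\<Sum>\<^sub>\<infinity>a\<in>A. f a) = (\<Sum>\<^sub>\<infinity>n. f (from_nat_into A n))"
    by (rule infsum_reindex_bij_betw[OF bij, symmetric])
  also have "\<dots> = (\<Sum>n. f (from_nat_into A n))"
    using sums by (simp add: sums_iff)
  also have "\<dots> = (\<integral>\<^sup>+a. f a \<partial>count_space A)"
    by (simp add: nn_integral_bij_count_space[OF bij, symmetric] nn_integral_count_space_nat)
  finally show ?thesis .
qed

lemma borel_measurable_nn_integral_countable:
  fixes f :: "'i \<Rightarrow> 'b \<Rightarrow> ennreal"
  assumes "countable I" and [measurable]: "\<And>i. i \<in> I \<Longrightarrow> f i \<in> borel_measurable N"
  shows "(\<lambda>x. \<integral>\<^sup>+i. f i x \<partial>count_space I) \<in> borel_measurable N"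
proof (cases "finite I")
  case True
  then show ?thesis by (simp add: nn_integral_count_space_finite)
next
  case False
  note bij = bij_betw_from_nat_into[OF assms(1) False]
  have [measurable]: "f (from_nat_into I n) \<in> borel_measurable N" for n
    using False by (intro assms(2) from_nat_into) auto
  show ?thesis
    by (simp add: nn_integral_bij_count_space[OF bij, symmetric] nn_integral_count_space_nat)
qed

text \<open>
  Translates a real conditional probability into the nonnegative conditional expectation, whose
  pull-out property holds for all nonnegative factors without integrability conditions. The value has
  to be finite almost everywhere, since otherwise the passage to the reals would lose it; it is at
  most 1.
\<close>

lemma (in finite_measure_subalgebra) ennreal_real_cond_exp_indicator:
  assumes [measurable]: "A \<in> sets M"
  shows "AE x in M. ennreal (real_cond_exp M F (indicator A) x) =
    nn_cond_exp M F (\<lambda>x. ennreal (indicator A x)) x"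
proof -
  have one: "AE x in M. 1 = nn_cond_exp M F (\<lambda>_. 1) x"
    by (rule nn_cond_exp_F_meas) simp
  have zero: "AE x in M. 0 = nn_cond_exp M F (\<lambda>_. 0) x"
    by (rule nn_cond_exp_F_meas) simp
  have mono: "AE x in M. nn_cond_exp M F (\<lambda>x. ennreal (indicator A x)) x \<le> nn_cond_exp M F (\<lambda>_. 1) x"
    by (rule nn_cond_exp_mono) (auto simp: indicator_def)
  have neg: "(\<lambda>x. ennreal (- indicator A x)) = (\<lambda>_. 0)"
    by (auto simp: indicator_def ennreal_neg)
  from one zero mono show ?thesis
  proof eventually_elim
    case (elim x)
    then have "nn_cond_exp M F (\<lambda>x. ennreal (indicator A x)) x < top"
      by (metis ennreal_one_less_top order.strict_trans1)
    with elim show ?case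
      unfolding real_cond_exp_def neg by simp
  qed
qed

section \<open>The coding map along admissible paths\<close>

lemma past_map_cong:
  "(\<And>k. k \<in> {- int n..0} \<Longrightarrow> \<sigma> k = \<tau> k) \<Longrightarrow> past_map M \<sigma> n = past_map M \<tau> n"
  by (induction n) auto

lemma coding_seq_cong:
  "(\<And>k. k \<in> {- int n..0} \<Longrightarrow> \<sigma> k = \<tau> k) \<Longrightarrow> coding_seq M x \<sigma> n = coding_seq M x \<tau> n"
  using past_map_cong[of n \<sigma> \<tau> M] by (simp add: coding_seq_def)

lemma Sigma_G_edge:
  assumes "\<sigma> \<in> Sigma_G M"
  obtains e where "e \<in> edges M" "\<sigma> k = Some e"
  using assms unfolding Sigma_G_def by blast

lemma Sigma_G_link: "\<sigma> \<in> Sigma_G M \<Longrightarrow> ini_ext M (\<sigma> (k + 1)) = ter_ext M (\<sigma> k)"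
  unfolding Sigma_G_def by blast

lemma Sigma_G_code_space: "\<sigma> \<in> Sigma_G M \<Longrightarrow> \<sigma> \<in> code_space (edges M)"
  by (simp add: Sigma_G_def)

lemma Sigma_G_shift: "\<sigma> \<in> Sigma_G M \<Longrightarrow> shift \<sigma> \<in> Sigma_G M"
  unfolding Sigma_G_def mem_Collect_eq shift_code_space unfolding shift_def by blast

lemma wmap_ext_maps:
  assumes "markov_system M" "\<sigma> \<in> Sigma_G M" "y \<in> piece M (ini_ext M (\<sigma> k))"
  shows "wmap_ext M (\<sigma> k) y \<in> piece M (ter_ext M (\<sigma> k))"
proof -
  obtain e where e: "e \<in> edges M" "\<sigma> k = Some e"
    using assms(2) by (rule Sigma_G_edge)
  then have "wmap M e ` ipiece M e \<subseteq> piece M (ter M e)"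
    using assms(1) unfolding markov_system_def by blast
  then show ?thesis
    using assms(3) e(2) by (simp add: wmap_ext_def ini_ext_def ter_ext_def image_subset_iff)
qed

text \<open>
  Along an admissible path the composed maps stay inside the partition: the terminal piece of one
  letter is the initial piece of the next. Hence the approximants of \<open>F(\<sigma>)\<close> lie in the
  piece of the terminal vertex of \<open>\<sigma>\<^sub>0\<close>.
\<close>

lemma past_map_maps:
  assumes "markov_system M" "\<sigma> \<in> Sigma_G M"
  shows "y \<in> piece M (ini_ext M (\<sigma> (- int n))) \<Longrightarrow> past_map M \<sigma> n y \<in> piece M (ter_ext M (\<sigma> 0))"
proof (induction n arbitrary: y)
  case 0
  then show ?case using wmap_ext_maps[OF assms, of y 0] by simp
next
  case (Suc n)
  have "wmap_ext M (\<sigma> (- int (Suc n))) y \<in> piece M (ini_ext M (\<sigma> (- int n)))"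
    using wmap_ext_maps[OF assms Suc.prems] Sigma_G_link[OF assms(2), of "- int (Suc n)"] by simp
  from Suc.IH[OF this] show ?case by simp
qed

lemma coding_seq_in_piece:
  assumes "markov_system M" "\<forall>j\<in>verts M. x j \<in> piece M j" "\<sigma> \<in> Sigma_G M"
  shows "coding_seq M x \<sigma> n \<in> piece M (ter_ext M (\<sigma> 0))"
proof -
  obtain e where "e \<in> edges M" "\<sigma> (- int n) = Some e"
    using assms(3) by (rule Sigma_G_edge)
  then have "ini_ext M (\<sigma> (- int n)) \<in> verts M"
    using assms(1) by (auto simp: ini_ext_def markov_system_def)
  then show ?thesis
    using past_map_maps[OF assms(1,3)] assms(2) by (simp add: coding_seq_def)
qed

text \<open>
  Shifting appends the letter \<open>\<sigma>\<^sub>1\<close> at the outer end of the composition and leaves the starting point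
  unchanged, at the price of an index one larger.
\<close>

lemma past_map_shift: "past_map M (shift \<sigma>) (Suc n) = wmap_ext M (\<sigma> 1) \<circ> past_map M \<sigma> n"
  by (induction n) (simp_all add: shift_def fun_eq_iff)

lemma coding_seq_shift:
  "coding_seq M x (shift \<sigma>) (Suc n) = wmap_ext M (\<sigma> 1) (coding_seq M x \<sigma> n)"
  unfolding coding_seq_def past_map_shift by (simp add: shift_def)

lemma coding_map_tendsto:
  assumes "\<sigma> \<in> coding_dom M x"
  shows "coding_seq M x \<sigma> \<longlonglongrightarrow> coding_map M x \<sigma>"
  using assms by (auto simp: coding_map_def coding_dom_def convergent_LIMSEQ_iff)

lemma coding_map_in_closure:
  assumes "markov_system M" "\<forall>j\<in>verts M. x j \<in> piece M j" "\<sigma> \<in> coding_dom M x"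
  shows "coding_map M x \<sigma> \<in> closure (piece M (ter_ext M (\<sigma> 0)))"
proof -
  have "\<sigma> \<in> Sigma_G M" using assms(3) by (simp add: coding_dom_def)
  then show ?thesis
    using coding_seq_in_piece[OF assms(1,2)] coding_map_tendsto[OF assms(3)]
    unfolding closure_sequential by blast
qed

text \<open>
  The equivariance \<open>F(S\<sigma>) = \<bar>w\<^sub>e(F(\<sigma>))\<close> for \<open>e = \<sigma>\<^sub>1\<close>. The map \<open>w\<^sub>e\<close> itself would not do: the limit may
  have left the initial piece of \<open>e\<close>, but it stays in the closure, on which the extension is
  continuous.
\<close>

lemma coding_map_shift:
  assumes M: "markov_system M" and v: "closure_maps M v" and x: "\<forall>j\<in>verts M. x j \<in> piece M j"
    and \<sigma>: "\<sigma> \<in> coding_dom M x" and e: "\<sigma> 1 = Some e"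
  shows "shift \<sigma> \<in> coding_dom M x" and "coding_map M x (shift \<sigma>) = v e (coding_map M x \<sigma>)"
proof -
  have G: "\<sigma> \<in> Sigma_G M" using \<sigma> by (simp add: coding_dom_def)
  have "e \<in> edges M" using Sigma_G_edge[OF G, of 1] e by auto
  then have ext: "continuous_extension (ipiece M e) (wmap M e) (v e)"
    using v by (simp add: closure_maps_def)
  have ini: "ini M e = ter_ext M (\<sigma> 0)"
    using Sigma_G_link[OF G, of 0] e by (simp add: ini_ext_def)
  have seq: "coding_seq M x \<sigma> n \<in> ipiece M e" for n
    using coding_seq_in_piece[OF M x G] ini by simp
  have "coding_map M x \<sigma> \<in> closure (ipiece M e)"
    using coding_map_in_closure[OF M x \<sigma>] ini by simp
  moreover have "\<forall>\<^sub>F n in sequentially. coding_seq M x \<sigma> n \<in> closure (ipiece M e)"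
    using seq closure_subset by (intro always_eventually) blast
  ultimately have "(\<lambda>n. v e (coding_seq M x \<sigma> n)) \<longlonglongrightarrow> v e (coding_map M x \<sigma>)"
    using ext coding_map_tendsto[OF \<sigma>] continuous_on_tendsto_compose
    unfolding continuous_extension_def by blast
  moreover have "v e (coding_seq M x \<sigma> n) = coding_seq M x (shift \<sigma>) (Suc n)" for n
    using ext seq e by (simp add: coding_seq_shift continuous_extension_def wmap_ext_def)
  ultimately have lim: "coding_seq M x (shift \<sigma>) \<longlonglongrightarrow> v e (coding_map M x \<sigma>)"
    by (intro LIMSEQ_imp_Suc[where f = "coding_seq M x (shift \<sigma>)"]) (simp only:)
  then show dom: "shift \<sigma> \<in> coding_dom M x"
    using Sigma_G_shift[OF G] by (auto simp: coding_dom_def convergent_def)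
  show "coding_map M x (shift \<sigma>) = v e (coding_map M x \<sigma>)"
    using coding_map_tendsto[OF dom] lim by (rule LIMSEQ_unique)
qed

section \<open>Measurability of the coding map and of the boundary operator\<close>

text \<open>
  The coding map is not measurable with respect to the past: its domain requires the whole
  two-sided path, future included, to be admissible. This variant asks only for convergence, which
  depends on the past alone, and it agrees with the coding map on the domain of the latter.
\<close>

definition past_limit :: "('a::complete_space, 'e) cms \<Rightarrow> (nat \<Rightarrow> 'a) \<Rightarrow> (int \<Rightarrow> 'e option) \<Rightarrow> 'a" where
  "past_limit M x \<sigma> = (if convergent (coding_seq M x \<sigma>) then lim (coding_seq M x \<sigma>) else x 1)"

lemma past_limit_eq_coding_map: "\<sigma> \<in> coding_dom M x \<Longrightarrow> past_limit M x \<sigma> = coding_map M x \<sigma>"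
  by (simp add: past_limit_def coding_map_def) (simp add: coding_dom_def)

lemma past_window_in_past_algebra:
  assumes "countable E"
    and "\<And>\<sigma> \<tau>. \<sigma> \<in> code_space E \<Longrightarrow> \<tau> \<in> code_space E \<Longrightarrow>
      (\<And>k. k \<in> {- int n..0} \<Longrightarrow> \<sigma> k = \<tau> k) \<Longrightarrow> P \<sigma> \<Longrightarrow> P \<tau>"
  shows "{\<sigma> \<in> code_space E. P \<sigma>} \<in> sets (past_algebra E)"
proof (rule window_determined_in_sets[where m = "- int n" and n = 0])
  show "cylinder E (- int n) 0 c \<in> sets (past_algebra E)" if "c \<in> code_space E" for c
    using that by (intro cylinder_in_past_algebra) simp_all
qed (fact assms space_past_algebra)+

lemma coding_seq_measurable:
  fixes M :: "('a::complete_space, 'b) cms"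
  assumes "countable (edges M)"
  shows "(\<lambda>\<sigma>. coding_seq M x \<sigma> n) \<in> borel_measurable (past_algebra (edges M))"
proof (rule measurableI)
  fix A :: "'a set"
  have "{\<sigma> \<in> code_space (edges M). coding_seq M x \<sigma> n \<in> A} \<in> sets (past_algebra (edges M))"
  proof (rule past_window_in_past_algebra[OF assms, of n])
    fix \<sigma> \<tau> :: "int \<Rightarrow> 'b option"
    assume "\<And>k. k \<in> {- int n..0} \<Longrightarrow> \<sigma> k = \<tau> k" and A: "coding_seq M x \<sigma> n \<in> A"
    then have "coding_seq M x \<sigma> n = coding_seq M x \<tau> n"
      by (intro coding_seq_cong)
    with A show "coding_seq M x \<tau> n \<in> A" by (simp only:)
  qed
  then show "(\<lambda>\<sigma>. coding_seq M x \<sigma> n) -` A \<inter> space (past_algebra (edges M))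
      \<in> sets (past_algebra (edges M))"
    by (simp add: vimage_def Int_def conj_commute)
qed simp

text \<open>
  Without separability of \<open>K\<close> the distance of two measurable maps need not be measurable, so the
  Cauchy criterion is expressed through events that depend on finitely many letters.
\<close>

lemma convergent_coding_seq_measurable:
  fixes M :: "('a::complete_space, 'e) cms"
  assumes "countable (edges M)"
  shows "{\<sigma> \<in> code_space (edges M). convergent (coding_seq M x \<sigma>)} \<in> sets (past_algebra (edges M))"
proof -
  let ?close = "\<lambda>\<sigma> j m n. dist (coding_seq M x \<sigma> m) (coding_seq M x \<sigma> n) < inverse (real (Suc j))"
  have "{\<sigma> \<in> space (past_algebra (edges M)). ?close \<sigma> j m n} \<in> sets (past_algebra (edges M))" for j m n
    unfolding space_past_algebra
  proof (rule past_window_in_past_algebra[OF assms, of "max m n"])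
    fix \<sigma> \<tau> assume agree: "\<And>k. k \<in> {- int (max m n)..0} \<Longrightarrow> \<sigma> k = \<tau> k" and close: "?close \<sigma> j m n"
    have "coding_seq M x \<sigma> i = coding_seq M x \<tau> i" if "i \<le> max m n" for i
    proof (rule coding_seq_cong)
      fix k assume "k \<in> {- int i..0}"
      moreover have "int i \<le> int (max m n)" using that by (simp only: of_nat_le_iff)
      ultimately have "k \<in> {- int (max m n)..0}" unfolding atLeastAtMost_iff by linarith
      then show "\<sigma> k = \<tau> k" by (rule agree)
    qed
    from this[of m] this[of n]
    have "coding_seq M x \<sigma> m = coding_seq M x \<tau> m" "coding_seq M x \<sigma> n = coding_seq M x \<tau> n"
      by simp_all
    with close show "?close \<tau> j m n" by (simp only:)
  qed
  then have "{\<sigma> \<in> space (past_algebra (edges M)). \<forall>j. \<exists>N. \<forall>m. \<forall>n. m \<ge> N \<longrightarrow> n \<ge> N \<longrightarrow> ?close \<sigma> j m n}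
      \<in> sets (past_algebra (edges M))"
    by (intro sets.sets_Collect_countable_All sets.sets_Collect_countable_Ex sets.sets_Collect_imp
        sets.sets_Collect_const)
  moreover have "convergent (coding_seq M x \<sigma>) \<longleftrightarrow>
      (\<forall>j. \<exists>N. \<forall>m. \<forall>n. m \<ge> N \<longrightarrow> n \<ge> N \<longrightarrow> ?close \<sigma> j m n)" for \<sigma>
    unfolding Cauchy_convergent_iff[symmetric] metric_Cauchy_iff2 by blast
  ultimately show ?thesis by (simp only: space_past_algebra)
qed

lemma past_limit_measurable:
  fixes M :: "('a::complete_space, 'e) cms"
  assumes "countable (edges M)"
  shows "past_limit M x \<in> borel_measurable (past_algebra (edges M))"
proof (rule borel_measurable_LIMSEQ_metric)
  let ?f = "\<lambda>n \<sigma>. if convergent (coding_seq M x \<sigma>) then coding_seq M x \<sigma> n else x 1"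
  show "?f n \<in> borel_measurable (past_algebra (edges M))" for n
    using convergent_coding_seq_measurable[OF assms] coding_seq_measurable[OF assms]
    by (intro measurable_If) auto
  show "(\<lambda>n. ?f n \<sigma>) \<longlonglongrightarrow> past_limit M x \<sigma>" for \<sigma>
    by (auto simp: past_limit_def convergent_LIMSEQ_iff)
qed

lemma Sigma_G_in_code_borel:
  assumes "countable (edges M)"
  shows "Sigma_G M \<in> sets (code_borel (edges M))"
proof -
  let ?P = "\<lambda>\<sigma> n. \<sigma> n \<in> Some ` edges M \<and> ini_ext M (\<sigma> (n + 1)) = ter_ext M (\<sigma> n)"
  have "{\<sigma> \<in> space (code_borel (edges M)). ?P \<sigma> n} \<in> sets (code_borel (edges M))" for n
    unfolding space_code_borel
    using assms cylinder_in_code_borel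
    by (intro window_determined_in_sets[where m = n and n = "n + 1"]) auto
  then have "{\<sigma> \<in> space (code_borel (edges M)). \<forall>n. ?P \<sigma> n} \<in> sets (code_borel (edges M))"
    by (rule sets.sets_Collect_countable_All)
  then show ?thesis by (simp add: Sigma_G_def)
qed

lemma T_set_in_code_borel:
  assumes "countable (edges M)"
  shows "T_set M j \<in> sets (code_borel (edges M))"
proof -
  have "{\<sigma> \<in> code_space (edges M). ter_ext M (\<sigma> 0) = j} \<in> sets (code_borel (edges M))"
    using assms cylinder_in_code_borel
    by (intro window_determined_in_sets[where m = 0 and n = 0]) auto
  moreover have "T_set M j = Sigma_G M \<inter> {\<sigma> \<in> code_space (edges M). ter_ext M (\<sigma> 0) = j}"
    by (auto simp: T_set_def Sigma_G_code_space)
  ultimately show ?thesis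
    using Sigma_G_in_code_borel[OF assms] by (simp add: sets.Int)
qed

lemma pbar_measurable:
  assumes "uniformly_continuous_on (ipiece M e) (pfun M e)"
  shows "pbar M e \<in> borel_measurable borel"
proof -
  have "continuous_extension (ipiece M e) (pfun M e)
      (SOME g. continuous_extension (ipiece M e) (pfun M e) g)"
    using continuous_extension_exists[OF assms] by (rule someI_ex)
  then have "(\<lambda>y. if y \<in> closure (ipiece M e)
      then (SOME g. continuous_extension (ipiece M e) (pfun M e) g) y else 0)
      \<in> borel_measurable borel"
    unfolding continuous_extension_def by (intro borel_measurable_continuous_on_if) auto
  then show ?thesis unfolding pbar_def[abs_def] .
qed

lemma boundary_p_measurable:
  assumes "markov_system M" "uniformly_continuous_system M" "e \<in> edges M"
  shows "boundary_p M e \<in> borel_measurable borel"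
proof -
  have [measurable]: "pbar M e \<in> borel_measurable borel"
    using assms(2,3) by (intro pbar_measurable) (simp add: uniformly_continuous_system_def)
  have "ini M e \<in> verts M" using assms(1,3) by (auto simp: markov_system_def)
  then have [measurable]: "ipiece M e \<in> sets borel" using assms(1) by (simp add: markov_system_def)
  have "closure (ipiece M e) - ipiece M e \<in> sets borel"
    by (rule sets.Diff[OF borel_closed[OF closed_closure]]) fact
  then show ?thesis
    unfolding boundary_p_def[abs_def] by (intro borel_measurable_times borel_measurable_indicator) auto
qed

lemma boundary_op_eq_nn_integral:
  assumes "countable (edges M)"
  shows "boundary_op M v f y =
    (\<integral>\<^sup>+e. ennreal (boundary_p M e y) * f (v e y) \<partial>count_space (edges M))"
  unfolding boundary_op_def by (rule infsum_eq_nn_integral_count_space[OF assms])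

lemma boundary_op_measurable:
  assumes "markov_system M" "uniformly_continuous_system M" "closure_maps M v"
    and [measurable]: "f \<in> borel_measurable borel"
  shows "boundary_op M v f \<in> borel_measurable borel"
proof -
  have c: "countable (edges M)" using assms(1) by (simp add: markov_system_def)
  have "(\<lambda>y. ennreal (boundary_p M e y) * f (v e y)) \<in> borel_measurable borel" if "e \<in> edges M" for e
  proof -
    have [measurable]: "boundary_p M e \<in> borel_measurable borel" "v e \<in> borel_measurable borel"
      using that boundary_p_measurable[OF assms(1,2)] assms(3) by (auto simp: closure_maps_def)
    show ?thesis by measurable
  qed
  then show ?thesis
    unfolding boundary_op_eq_nn_integral[OF c]
    by (rule borel_measurable_nn_integral_countable[OF c])
qed

lemma boundary_op_iterate_measurable:
  assumes "markov_system M" "uniformly_continuous_system M" "closure_maps M v"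
  shows "(boundary_op M v ^^ n) (\<lambda>_. 1) \<in> borel_measurable borel"
  by (induction n) (simp_all add: boundary_op_measurable[OF assms])

lemma coding_dom_in_code_borel:
  fixes M :: "('a::complete_space, 'e) cms"
  assumes "countable (edges M)"
  shows "coding_dom M x \<in> sets (code_borel (edges M))"
proof -
  have "coding_dom M x =
      Sigma_G M \<inter> {\<sigma> \<in> code_space (edges M). convergent (coding_seq M x \<sigma>)}"
    by (auto simp: coding_dom_def Sigma_G_code_space)
  moreover have "{\<sigma> \<in> code_space (edges M). convergent (coding_seq M x \<sigma>)} \<in> sets (code_borel (edges M))"
    using convergent_coding_seq_measurable[OF assms] past_algebra_le_code_borel by blast
  ultimately show ?thesis
    using Sigma_G_in_code_borel[OF assms] by (simp only: sets.Int)
qed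

text \<open>
  Needed because \<^const>\<open>measure\<close> gives the value 0 to non-measurable sets as well: only for measurable
  \<open>T\<^sub>j \<inter> F\<^sup>-\<^sup>1(K\<^sub>j)\<close> does degeneracy produce null sets.
\<close>

lemma coding_map_measurable:
  fixes M :: "('a::complete_space, 'e) cms"
  assumes "countable (edges M)"
  shows "coding_map M x \<in> borel_measurable (code_borel (edges M))"
proof -
  let ?B = "code_borel (edges M)"
  have "past_limit M x \<in> borel_measurable ?B"
    by (rule measurable_from_subalg[OF _ past_limit_measurable[OF assms]])
       (simp add: subalgebra_def past_algebra_le_code_borel)
  moreover have "(\<lambda>\<sigma>. x (ter_ext M (\<sigma> 0))) \<in> borel_measurable ?B"
  proof (rule measurableI)
    fix A :: "'a set"
    have "{\<sigma> \<in> code_space (edges M). x (ter_ext M (\<sigma> 0)) \<in> A} \<in> sets ?B"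
      using assms cylinder_in_code_borel
      by (intro window_determined_in_sets[where m = 0 and n = 0]) auto
    then show "(\<lambda>\<sigma>. x (ter_ext M (\<sigma> 0))) -` A \<inter> space ?B \<in> sets ?B"
      by (simp add: vimage_def Int_def conj_commute)
  qed simp
  moreover have "{\<sigma> \<in> space ?B. \<sigma> \<in> coding_dom M x} \<in> sets ?B"
    using sets.Int[OF sets.top coding_dom_in_code_borel[OF assms]] by (simp only: Int_def)
  ultimately have "(\<lambda>\<sigma>. if \<sigma> \<in> coding_dom M x then past_limit M x \<sigma> else x (ter_ext M (\<sigma> 0)))
      \<in> borel_measurable ?B"
    by (rule measurable_If)
  also have "(\<lambda>\<sigma>. if \<sigma> \<in> coding_dom M x then past_limit M x \<sigma> else x (ter_ext M (\<sigma> 0))) = coding_map M x"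
    by (rule ext) (simp add: past_limit_eq_coding_map, simp add: coding_map_def)
  finally show ?thesis .
qed

section \<open>Invariant measures of a degenerate system\<close>

lemma E_tilde_unfold:
  assumes "\<Lambda> \<in> E_tilde M x"
  shows "prob_space \<Lambda>" and "sets \<Lambda> = sets (code_borel (edges M))"
    and "space \<Lambda> = code_space (edges M)" and "distr \<Lambda> \<Lambda> shift = \<Lambda>"
    and "finite_measure_subalgebra \<Lambda> (past_algebra (edges M))"
    and "AE \<sigma> in \<Lambda>. \<sigma> \<in> coding_dom M x"
proof -
  show P: "prob_space \<Lambda>" and S: "sets \<Lambda> = sets (code_borel (edges M))"
    and "distr \<Lambda> \<Lambda> shift = \<Lambda>"
    using assms by (auto simp: E_tilde_def invariant_probs_def)
  show sp: "space \<Lambda> = code_space (edges M)"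
    using sets_eq_imp_space_eq[OF S] by simp
  interpret prob_space \<Lambda> by (rule P)
  show "finite_measure_subalgebra \<Lambda> (past_algebra (edges M))"
    using past_algebra_le_code_borel[of "edges M"]
    by unfold_locales (simp add: subalgebra_def S sp)
  have "prob (coding_dom M x) = 1"
    using assms by (simp add: E_tilde_def)
  then show "AE \<sigma> in \<Lambda>. \<sigma> \<in> coding_dom M x"
    by (rule AE_prob_1)
qed

text \<open>
  On its domain the coding map has values in the closure of the piece of \<open>t(\<sigma>\<^sub>0)\<close>, and degeneracy
  excludes the piece itself up to countably many null sets, one for each vertex.
\<close>

lemma degenerate_imp_boundary:
  assumes M: "markov_system M" and x: "\<forall>j\<in>verts M. x j \<in> piece M j"
    and L: "\<Lambda> \<in> E_tilde M x"
    and deg: "\<And>j. j \<in> verts M \<Longrightarrow> measure \<Lambda> (T_set M j \<inter> coding_map M x -` piece M j) = 0"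
  shows "AE \<sigma> in \<Lambda>. coding_map M x \<sigma> \<in>
    closure (piece M (ter_ext M (\<sigma> 0))) - piece M (ter_ext M (\<sigma> 0))"
proof -
  note E = E_tilde_unfold[OF L]
  interpret prob_space \<Lambda> by (rule E(1))
  have c: "countable (edges M)" using M by (simp add: markov_system_def)
  have "AE \<sigma> in \<Lambda>. \<sigma> \<notin> T_set M j \<inter> coding_map M x -` piece M j" if j: "j \<in> verts M" for j
  proof -
    have "piece M j \<in> sets borel" using M j by (simp add: markov_system_def)
    then have "coding_map M x -` piece M j \<inter> space \<Lambda> \<in> sets \<Lambda>"
      using measurable_sets[OF coding_map_measurable[OF c]] by (simp add: E(2,3))
    moreover have "T_set M j \<in> sets \<Lambda>"
      using T_set_in_code_borel[OF c] by (simp add: E(2))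
    moreover have "T_set M j \<inter> coding_map M x -` piece M j =
        T_set M j \<inter> (coding_map M x -` piece M j \<inter> space \<Lambda>)"
      by (auto simp: E(3) T_set_def Sigma_G_code_space)
    ultimately have "T_set M j \<inter> coding_map M x -` piece M j \<in> sets \<Lambda>"
      by (simp only: sets.Int)
    then show ?thesis
      using deg[OF j] by (intro AE_not_in null_setsI) (simp_all add: emeasure_eq_measure)
  qed
  then have "AE \<sigma> in \<Lambda>. \<forall>j\<in>verts M. \<sigma> \<notin> T_set M j \<inter> coding_map M x -` piece M j"
    by (simp add: AE_ball_countable del: Int_iff)
  then show ?thesis using E(6)
  proof eventually_elim
    case (elim \<sigma>)
    then have G: "\<sigma> \<in> Sigma_G M" by (simp add: coding_dom_def)
    then obtain e where "e \<in> edges M" "\<sigma> 0 = Some e" by (rule Sigma_G_edge)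
    then have "ter_ext M (\<sigma> 0) \<in> verts M"
      using M by (auto simp: ter_ext_def markov_system_def)
    then show ?case
      using elim G coding_map_in_closure[OF M x] by (auto simp: T_set_def)
  qed
qed

text \<open>
  Once \<open>F\<close> takes its values in the boundary of the relevant piece, \<open>\<bar>p\<^sub>e \<circ> F\<close> and \<open>\<partial>p\<^sub>e \<circ> F\<close> coincide on
  \<open>T\<^bsub>i(e)\<^esub>\<close>. Outside \<open>T\<^bsub>i(e)\<^esub>\<close> the conditional probability vanishes while \<open>\<partial>p\<^sub>e \<circ> F\<close> may be positive, so
  only an inequality remains.
\<close>

lemma cond_prob_le_boundary_p:
  assumes M: "markov_system M" and x: "\<forall>j\<in>verts M. x j \<in> piece M j"
    and L: "\<Lambda> \<in> E_tilde M x"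
    and bd: "AE \<sigma> in \<Lambda>. coding_map M x \<sigma> \<in>
      closure (piece M (ter_ext M (\<sigma> 0))) - piece M (ter_ext M (\<sigma> 0))"
    and e: "e \<in> edges M"
  shows "AE \<sigma> in \<Lambda>. nn_cond_exp \<Lambda> (past_algebra (edges M))
      (\<lambda>\<sigma>. ennreal (indicator (cylinder (edges M) 1 1 (\<lambda>_. Some e)) \<sigma>)) \<sigma>
    \<le> ennreal (boundary_p M e (coding_map M x \<sigma>))"
proof -
  note E = E_tilde_unfold[OF L]
  interpret finite_measure_subalgebra \<Lambda> "past_algebra (edges M)" by (rule E(5))
  have "cylinder (edges M) 1 1 (\<lambda>_. Some e) \<in> sets \<Lambda>"
    by (simp add: E(2) cylinder_in_code_borel)
  note ennreal_real_cond_exp_indicator[OF this]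
  moreover have "AE \<sigma> in \<Lambda>. real_cond_exp \<Lambda> (past_algebra (edges M))
      (indicator (cylinder (edges M) 1 1 (\<lambda>_. Some e))) \<sigma>
    = pbar M e (coding_map M x \<sigma>) * indicator (T_set M (ini M e)) \<sigma>"
    using L e by (simp add: E_tilde_def)
  ultimately show ?thesis using bd
  proof eventually_elim
    case (elim \<sigma>)
    have "ennreal (pbar M e (coding_map M x \<sigma>) * indicator (T_set M (ini M e)) \<sigma>)
        \<le> ennreal (boundary_p M e (coding_map M x \<sigma>))"
    proof (cases "\<sigma> \<in> T_set M (ini M e)")
      case True
      then have "coding_map M x \<sigma> \<in> closure (ipiece M e) - ipiece M e"
        using elim(3) by (simp add: T_set_def)
      then show ?thesis using True by (simp add: boundary_p_def)
    qed simp
    then show ?case using elim(1,2) by (simp only:)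
  qed
qed

text \<open>
  The integrated form of \<open>E(g \<circ> F \<circ> S | past) \<le> (R g) \<circ> F\<close>: split according to the letter \<open>\<sigma>\<^sub>1 = e\<close>, on
  which \<open>F \<circ> S = \<bar>w\<^sub>e \<circ> F\<close>, pull the past-measurable factor out of the conditional probability of that
  letter, and estimate this probability by \<open>\<partial>p\<^sub>e \<circ> F\<close>.
\<close>

lemma boundary_op_dominates_shift:
  assumes M: "markov_system M" and u: "uniformly_continuous_system M" and v: "closure_maps M v"
    and x: "\<forall>j\<in>verts M. x j \<in> piece M j"
    and L: "\<Lambda> \<in> E_tilde M x"
    and bd: "AE \<sigma> in \<Lambda>. coding_map M x \<sigma> \<in>
      closure (piece M (ter_ext M (\<sigma> 0))) - piece M (ter_ext M (\<sigma> 0))"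
    and g [measurable]: "g \<in> borel_measurable borel"
    and B: "B \<in> sets (past_algebra (edges M))"
  shows "(\<integral>\<^sup>+\<sigma>. indicator B \<sigma> * g (coding_map M x (shift \<sigma>)) \<partial>\<Lambda>)
    \<le> (\<integral>\<^sup>+\<sigma>. indicator B \<sigma> * boundary_op M v g (past_limit M x \<sigma>) \<partial>\<Lambda>)"
proof -
  note E = E_tilde_unfold[OF L]
  interpret finite_measure_subalgebra \<Lambda> "past_algebra (edges M)" by (rule E(5))
  have c: "countable (edges M)" using M by (simp add: markov_system_def)
  define cyl where "cyl e = cylinder (edges M) 1 1 (\<lambda>_. Some e)" for e
  define q where "q e = nn_cond_exp \<Lambda> (past_algebra (edges M)) (\<lambda>\<sigma>. ennreal (indicator (cyl e) \<sigma>))" for e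
  \<comment> \<open>The factor that depends on the past once the next letter \<open>e\<close> is given.\<close>
  define h where "h e \<sigma> = indicator B \<sigma> * g (v e (past_limit M x \<sigma>))" for e \<sigma>
  define b where "b e \<sigma> = ennreal (boundary_p M e (past_limit M x \<sigma>))" for e \<sigma>
  have cyl_sets: "cyl e \<in> sets \<Lambda>" for e
    by (simp add: cyl_def E(2) cylinder_in_code_borel)
  have pl [measurable]: "past_limit M x \<in> borel_measurable (past_algebra (edges M))"
    by (rule past_limit_measurable[OF c])
  have ind: "indicator B \<in> borel_measurable (past_algebra (edges M))"
    using B by (rule borel_measurable_indicator)
  have h_past: "h e \<in> borel_measurable (past_algebra (edges M))" if "e \<in> edges M" for e
  proof -
    have [measurable]: "v e \<in> borel_measurable borel" using v that by (simp add: closure_maps_def)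
    have "(\<lambda>\<sigma>. g (v e (past_limit M x \<sigma>))) \<in> borel_measurable (past_algebra (edges M))"
      by measurable
    then show ?thesis unfolding h_def[abs_def] by (intro borel_measurable_times_ennreal ind)
  qed
  have h_meas: "h e \<in> borel_measurable \<Lambda>" if "e \<in> edges M" for e
    by (rule measurable_from_subalg[OF subalg h_past[OF that]])
  have b_meas: "b e \<in> borel_measurable \<Lambda>" if "e \<in> edges M" for e
  proof -
    have [measurable]: "boundary_p M e \<in> borel_measurable borel"
      by (rule boundary_p_measurable[OF M u that])
    have "b e \<in> borel_measurable (past_algebra (edges M))" unfolding b_def[abs_def] by measurable
    then show ?thesis by (rule measurable_from_subalg[OF subalg])
  qed
  have ind_meas: "(\<lambda>\<sigma>. ennreal (indicator (cyl e) \<sigma>)) \<in> borel_measurable \<Lambda>" for e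
    using cyl_sets by measurable
  have "(\<integral>\<^sup>+\<sigma>. indicator B \<sigma> * g (coding_map M x (shift \<sigma>)) \<partial>\<Lambda>)
      = (\<integral>\<^sup>+\<sigma>. \<integral>\<^sup>+e. h e \<sigma> * ennreal (indicator (cyl e) \<sigma>) \<partial>count_space (edges M) \<partial>\<Lambda>)"
  proof (rule nn_integral_cong_AE)
    show "AE \<sigma> in \<Lambda>. indicator B \<sigma> * g (coding_map M x (shift \<sigma>)) =
        (\<integral>\<^sup>+e. h e \<sigma> * ennreal (indicator (cyl e) \<sigma>) \<partial>count_space (edges M))"
      using E(6)
    proof eventually_elim
      case (elim \<sigma>)
      then have G: "\<sigma> \<in> Sigma_G M" by (simp add: coding_dom_def)
      obtain e where e: "e \<in> edges M" "\<sigma> 1 = Some e"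
        using G by (rule Sigma_G_edge)
      have cyl_iff: "\<sigma> \<in> cyl e' \<longleftrightarrow> e' = e" for e'
        using Sigma_G_code_space[OF G] e(2) by (auto simp: cyl_def cylinder_def)
      \<comment> \<open>The cylinders of the possible next letters partition the admissible paths, so one term survives.\<close>
      have "(\<integral>\<^sup>+e. h e \<sigma> * ennreal (indicator (cyl e) \<sigma>) \<partial>count_space (edges M)) =
          (\<Sum>e'\<in>{e}. h e' \<sigma> * ennreal (indicator (cyl e') \<sigma>))"
        by (rule nn_integral_count_space') (use e cyl_iff in auto)
      also have "\<dots> = h e \<sigma>" by (simp add: cyl_iff)
      finally show ?case
        using coding_map_shift(2)[OF M v x elim e(2)] past_limit_eq_coding_map[OF elim]
        by (simp add: h_def)
    qed
  qed
  also have "\<dots> = (\<integral>\<^sup>+e. \<integral>\<^sup>+\<sigma>. h e \<sigma> * ennreal (indicator (cyl e) \<sigma>) \<partial>\<Lambda> \<partial>count_space (edges M))"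
    by (rule nn_integral_count_space_nn_integral[OF c])
       (intro borel_measurable_times_ennreal h_meas ind_meas)
  also have "\<dots> = (\<integral>\<^sup>+e. \<integral>\<^sup>+\<sigma>. h e \<sigma> * q e \<sigma> \<partial>\<Lambda> \<partial>count_space (edges M))"
    unfolding q_def
    by (intro nn_integral_cong nn_cond_exp_intg[symmetric] h_past ind_meas) simp
  also have "\<dots> \<le> (\<integral>\<^sup>+e. \<integral>\<^sup>+\<sigma>. h e \<sigma> * b e \<sigma> \<partial>\<Lambda> \<partial>count_space (edges M))"
  proof (rule nn_integral_mono, rule nn_integral_mono_AE)
    fix e assume "e \<in> space (count_space (edges M))"
    then have "AE \<sigma> in \<Lambda>. q e \<sigma> \<le> ennreal (boundary_p M e (coding_map M x \<sigma>))"
      unfolding q_def cyl_def by (intro cond_prob_le_boundary_p[OF M x L bd]) simp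
    then show "AE \<sigma> in \<Lambda>. h e \<sigma> * q e \<sigma> \<le> h e \<sigma> * b e \<sigma>"
      using E(6)
    proof eventually_elim
      case (elim \<sigma>)
      then show ?case
        unfolding b_def past_limit_eq_coding_map[OF elim(2)] by (intro mult_left_mono) simp_all
    qed
  qed
  also have "\<dots> = (\<integral>\<^sup>+\<sigma>. \<integral>\<^sup>+e. h e \<sigma> * b e \<sigma> \<partial>count_space (edges M) \<partial>\<Lambda>)"
    by (rule nn_integral_count_space_nn_integral[OF c, symmetric])
       (intro borel_measurable_times_ennreal h_meas b_meas)
  also have "\<dots> = (\<integral>\<^sup>+\<sigma>. indicator B \<sigma> * boundary_op M v g (past_limit M x \<sigma>) \<partial>\<Lambda>)"
  proof (rule nn_integral_cong)
    show "(\<integral>\<^sup>+e. h e \<sigma> * b e \<sigma> \<partial>count_space (edges M)) =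
        indicator B \<sigma> * boundary_op M v g (past_limit M x \<sigma>)" for \<sigma>
      unfolding boundary_op_eq_nn_integral[OF c] h_def b_def
      by (subst nn_integral_cmult[symmetric]) (simp_all only: borel_measurable_count_space mult_ac)
  qed
  finally show ?thesis .
qed

text \<open>
  One application of \<open>R\<close> preserves the lower bound 1 along \<open>F\<close>. By invariance \<open>g \<circ> F \<circ> S \<ge> 1\<close> almost surely,
  so the preceding inequality on the past event \<open>B = {(R g) \<circ> F < 1}\<close> gives
  \<open>\<Lambda>(B) \<le> \<integral>\<^sub>B (R g) \<circ> F\<close>, which is impossible unless \<open>B\<close> is null.
\<close>

lemma one_le_boundary_op:
  assumes M: "markov_system M" and u: "uniformly_continuous_system M" and v: "closure_maps M v"
    and x: "\<forall>j\<in>verts M. x j \<in> piece M j"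
    and L: "\<Lambda> \<in> E_tilde M x"
    and bd: "AE \<sigma> in \<Lambda>. coding_map M x \<sigma> \<in>
      closure (piece M (ter_ext M (\<sigma> 0))) - piece M (ter_ext M (\<sigma> 0))"
    and g [measurable]: "g \<in> borel_measurable borel"
    and one_le: "AE \<sigma> in \<Lambda>. 1 \<le> g (coding_map M x \<sigma>)"
  shows "AE \<sigma> in \<Lambda>. 1 \<le> boundary_op M v g (coding_map M x \<sigma>)"
proof (rule ccontr)
  assume contra: "\<not> ?thesis"
  note E = E_tilde_unfold[OF L]
  interpret prob_space \<Lambda> by (rule E(1))
  interpret finite_measure_subalgebra \<Lambda> "past_algebra (edges M)" by (rule E(5))
  have c: "countable (edges M)" using M by (simp add: markov_system_def)
  define r where "r \<sigma> = boundary_op M v g (past_limit M x \<sigma>)" for \<sigma>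
  define B where "B = {\<sigma> \<in> space (past_algebra (edges M)). r \<sigma> < 1}"
  have r_past [measurable]: "r \<in> borel_measurable (past_algebra (edges M))"
    unfolding r_def[abs_def]
    by (rule measurable_compose[OF past_limit_measurable[OF c] boundary_op_measurable[OF M u v g]])
  have B: "B \<in> sets (past_algebra (edges M))"
    unfolding B_def by measurable
  then have B\<Lambda>: "B \<in> sets \<Lambda>"
    using subalg unfolding subalgebra_def by blast
  have r_meas: "r \<in> borel_measurable \<Lambda>"
    by (rule measurable_from_subalg[OF subalg r_past])
  have le: "indicator B \<sigma> * r \<sigma> \<le> indicator B \<sigma>" for \<sigma>
    by (auto simp: B_def indicator_def intro: less_imp_le)
  \<comment> \<open>Strict monotonicity of the integral requires a finite left-hand side.\<close>
  have finite: "(\<integral>\<^sup>+\<sigma>. indicator B \<sigma> * r \<sigma> \<partial>\<Lambda>) \<noteq> \<infinity>"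
  proof -
    have "(\<integral>\<^sup>+\<sigma>. indicator B \<sigma> * r \<sigma> \<partial>\<Lambda>) \<le> (\<integral>\<^sup>+\<sigma>. indicator B \<sigma> \<partial>\<Lambda>)"
      by (rule nn_integral_mono) (rule le)
    also have "\<dots> < \<infinity>" using B\<Lambda> by (simp add: emeasure_eq_measure)
    finally show ?thesis by simp
  qed
  have "\<not> (AE \<sigma> in \<Lambda>. (indicator B \<sigma> :: ennreal) \<le> indicator B \<sigma> * r \<sigma>)"
  proof
    assume "AE \<sigma> in \<Lambda>. (indicator B \<sigma> :: ennreal) \<le> indicator B \<sigma> * r \<sigma>"
    then have "AE \<sigma> in \<Lambda>. 1 \<le> boundary_op M v g (coding_map M x \<sigma>)"
      using E(6)
    proof eventually_elim
      case (elim \<sigma>)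
      have "\<sigma> \<in> space (past_algebra (edges M))"
        using elim(2) by (simp add: coding_dom_def Sigma_G_code_space)
      then have "1 \<le> r \<sigma>"
        using elim(1) by (cases "\<sigma> \<in> B") (auto simp: B_def not_less)
      then show ?case by (simp add: r_def past_limit_eq_coding_map[OF elim(2)])
    qed
    with contra show False by blast
  qed
  then have "(\<integral>\<^sup>+\<sigma>. indicator B \<sigma> * r \<sigma> \<partial>\<Lambda>) < (\<integral>\<^sup>+\<sigma>. indicator B \<sigma> \<partial>\<Lambda>)"
    using finite le
    by (intro nn_integral_less borel_measurable_times_ennreal borel_measurable_indicator B\<Lambda> r_meas)
      simp_all
  also have "\<dots> \<le> (\<integral>\<^sup>+\<sigma>. indicator B \<sigma> * g (coding_map M x (shift \<sigma>)) \<partial>\<Lambda>)"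
  proof (rule nn_integral_mono_AE)
    have "shift \<in> measurable \<Lambda> \<Lambda>"
      using shift_measurable measurable_cong_sets[OF E(2) E(2)] by blast
    moreover have "AE \<sigma> in distr \<Lambda> \<Lambda> shift. 1 \<le> g (coding_map M x \<sigma>)"
      unfolding E(4) by (rule one_le)
    ultimately have "AE \<sigma> in \<Lambda>. 1 \<le> g (coding_map M x (shift \<sigma>))"
      by (rule AE_distrD)
    then show "AE \<sigma> in \<Lambda>. indicator B \<sigma> \<le> indicator B \<sigma> * g (coding_map M x (shift \<sigma>))"
      by eventually_elim (simp add: indicator_def)
  qed
  also have "\<dots> \<le> (\<integral>\<^sup>+\<sigma>. indicator B \<sigma> * r \<sigma> \<partial>\<Lambda>)"
    unfolding r_def by (rule boundary_op_dominates_shift[OF M u v x L bd g B])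
  finally show False by simp
qed

theorem lemma8:
  fixes M :: "('a::complete_space, 'e) cms"
    and v :: "'e \<Rightarrow> 'a \<Rightarrow> 'a"
    and x :: "nat \<Rightarrow> 'a"
  assumes "markov_system M"
    and "uniformly_continuous_system M"
    and "closure_maps M v"
    and "\<forall>j\<in>verts M. x j \<in> piece M j"
    and "coding_map M x -` Omega_set M v \<inter> code_space (edges M) = {}"
  shows "non_degenerate M x"
proof (rule ccontr)
  assume "\<not> non_degenerate M x"
  then obtain \<Lambda> where L: "\<Lambda> \<in> E_tilde M x"
    and deg: "\<And>j. j \<in> verts M \<Longrightarrow> measure \<Lambda> (T_set M j \<inter> coding_map M x -` piece M j) = 0"
    unfolding non_degenerate_def by (metis measure_nonneg order_le_less)
  interpret prob_space \<Lambda> by (rule E_tilde_unfold(1)[OF L])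
  note bd = degenerate_imp_boundary[OF assms(1,4) L deg]
  have "AE \<sigma> in \<Lambda>. 1 \<le> (boundary_op M v ^^ n) (\<lambda>_. 1) (coding_map M x \<sigma>)" for n
  proof (induction n)
    case (Suc n)
    show ?case
      using one_le_boundary_op[OF assms(1-4) L bd boundary_op_iterate_measurable[OF assms(1-3)] Suc.IH]
      by simp
  qed simp
  then have "AE \<sigma> in \<Lambda>. \<forall>n. 1 \<le> (boundary_op M v ^^ n) (\<lambda>_. 1) (coding_map M x \<sigma>)"
    by (simp add: AE_all_countable)
  then have "AE \<sigma> in \<Lambda>. False"
    using E_tilde_unfold(6)[OF L]
  proof eventually_elim
    case (elim \<sigma>)
    then have "coding_map M x \<sigma> \<in> Omega_set M v"
      by (simp add: Omega_set_def)
    moreover have "\<sigma> \<in> code_space (edges M)"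
      using elim(2) by (simp add: coding_dom_def Sigma_G_code_space)
    ultimately show False using assms(5) by blast
  qed
  then show False by simp
qed

end
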